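(* Let $p,q>0$. For $D\ge 1$ let $f_D(t;p,q)$ be the expected fraction of adopters on the infinite $D$-dimensional homogeneous Cartesian network, and let $f_{\rm Bass}(t;p,q)=\frac{1-e^{-(p+q)t}}{1+\frac qp e^{-(p+q)t}}$. Then $$f_1(t;p,q)<f_2(t;p,q)<f_3(t;p,q)<\dots<f_{\rm Bass}(t;p,q),\qquad 0<t\ll1,$$ i.e. for every $D\ge1$ there exists $\tau_D>0$ such that $f_D(t;p,q)<f_{D+1}(t;p,q)<f_{\rm Bass}(t;p,q)$ for all $0<t<\tau_D$.
   Context: Infinite $D$-dimensional homogeneous Cartesian network: nodes are ${\bf i}\in\mathbb{Z}^D$, each with external rate $p$, and internal rates $q_{{\bf i},{\bf j}}=\frac{q}{2D}$ if $\|{\bf i}-{\bf j}\|_1=\sum_{k=1}^D|i_k-j_k|=1$ and $q_{{\bf i},{\bf j}}=0$ otherwise. $X_{\bf j}(t)\in\{0,1\}$ is the state of node ${\bf j}$ ($1$ = adopter), all nodes are nonadopters at $t=0$, adopters remain adopters forever, and each nonadopter ${\bf j}$ becomes an adopter at rate $p+\sum_{{\bf k}\neq{\bf j}}q_{{\bf k},{\bf j}}X_{\bf k}(t)$ (a continuous-time Markov interacting particle system). By translation invariance, $f_D(t;p,q)=\mathrm{Prob}(X_{\bf j}(t)=1)$ for any node ${\bf j}$. *)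

theory Defs
  imports "HOL-Probability.Probability"
begin

definition adoption_rate ::
  "'v set \<Rightarrow> real \<Rightarrow> ('v \<Rightarrow> 'v \<Rightarrow> real) \<Rightarrow> ('v \<Rightarrow> bool) \<Rightarrow> 'v \<Rightarrow> real" where
  "adoption_rate V p Q \<eta> j = p + infsum (\<lambda>k. Q k j * of_bool (\<eta> k)) (V - {j})"

text \<open>The generator of the particle system: a nonadopter \<open>j\<close> flips at its adoption rate.
  It is meant for functions depending on finitely many nodes and for matrices \<open>Q\<close>
  with finitely many nonzero entries in each column; both sums are then finite.\<close>

definition bass_generator ::
  "'v set \<Rightarrow> real \<Rightarrow> ('v \<Rightarrow> 'v \<Rightarrow> real) \<Rightarrow> (('v \<Rightarrow> bool) \<Rightarrow> real) \<Rightarrow> ('v \<Rightarrow> bool) \<Rightarrow> real" where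
  "bass_generator V p Q g \<eta> =
     infsum (\<lambda>j. of_bool (\<not> \<eta> j) * adoption_rate V p Q \<eta> j * (g (\<eta>(j := True)) - g \<eta>)) V"

definition depends_on :: "'v set \<Rightarrow> (('v \<Rightarrow> bool) \<Rightarrow> real) \<Rightarrow> bool" where
  "depends_on A g \<longleftrightarrow> (\<forall>\<eta> \<zeta>. (\<forall>i\<in>A. \<eta> i = \<zeta> i) \<longrightarrow> g \<eta> = g \<zeta>)"

definition history ::
  "'w measure \<Rightarrow> 'v set \<Rightarrow> (real \<Rightarrow> 'w \<Rightarrow> 'v \<Rightarrow> bool) \<Rightarrow> real \<Rightarrow> 'w measure" where
  "history M V X s =
     sigma (space M) {{\<omega> \<in> space M. X u \<omega> j} | u j. 0 \<le> u \<and> u \<le> s \<and> j \<in> V}"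

definition dynkin_process ::
  "'v set \<Rightarrow> real \<Rightarrow> ('v \<Rightarrow> 'v \<Rightarrow> real) \<Rightarrow> (real \<Rightarrow> 'w \<Rightarrow> 'v \<Rightarrow> bool) \<Rightarrow>
     (('v \<Rightarrow> bool) \<Rightarrow> real) \<Rightarrow> real \<Rightarrow> 'w \<Rightarrow> real" where
  "dynkin_process V p Q X g t \<omega> =
     g (X t \<omega>) - (LINT u:{0..t}|lborel. bass_generator V p Q g (X u \<omega>))"

text \<open>\<open>X t \<omega> j\<close> says that node \<open>j\<close> is an adopter at time \<open>t\<close>; only \<open>t \<ge> 0\<close> and
  \<open>j \<in> V\<close> matter. That the transition rates are those of the Bass model is expressed,
  as usual for an interacting particle system with infinitely many nodes, by the
  martingale problem for its generator. When the rates are bounded and of finite range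
  this problem is well-posed (Liggett), so it determines the law of the
  process and makes it Markov.\<close>

locale bass_network = prob_space M
  for M :: "'w measure" and V :: "'v set" and p :: real and Q :: "'v \<Rightarrow> 'v \<Rightarrow> real"
    and X :: "real \<Rightarrow> 'w \<Rightarrow> 'v \<Rightarrow> bool" +
  assumes state_measurable:
      "\<And>t j. 0 \<le> t \<Longrightarrow> j \<in> V \<Longrightarrow> (\<lambda>\<omega>. X t \<omega> j) \<in> measurable M (count_space UNIV)"
    and all_nonadopters_initially:
      "\<And>j \<omega>. j \<in> V \<Longrightarrow> \<omega> \<in> space M \<Longrightarrow> \<not> X 0 \<omega> j"
    and adopters_remain:
      "\<And>s t j \<omega>. 0 \<le> s \<Longrightarrow> s \<le> t \<Longrightarrow> j \<in> V \<Longrightarrow> \<omega> \<in> space M \<Longrightarrow> X s \<omega> j \<Longrightarrow> X t \<omega> j"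
    and right_continuous:
      "\<And>t j \<omega>. 0 \<le> t \<Longrightarrow> j \<in> V \<Longrightarrow> \<omega> \<in> space M \<Longrightarrow>
         eventually (\<lambda>u. X u \<omega> j = X t \<omega> j) (at_right t)"
    and martingale_problem:
      "\<And>A g s t. finite A \<Longrightarrow> A \<subseteq> V \<Longrightarrow> depends_on A g \<Longrightarrow> 0 \<le> s \<Longrightarrow> s \<le> t \<Longrightarrow>
         AE \<omega> in M. real_cond_exp M (history M V X s) (dynkin_process V p Q X g t) \<omega>
                     = dynkin_process V p Q X g s \<omega>"

text \<open>The lattice \<open>\<int>\<^sup>D\<close>: integer functions on \<open>{..<D}\<close>, so that all dimensions share one
  type.\<close>

definition lattice_nodes :: "nat \<Rightarrow> (nat \<Rightarrow> int) set" where
  "lattice_nodes D = {..<D} \<rightarrow>\<^sub>E UNIV"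

definition lattice_rate :: "nat \<Rightarrow> real \<Rightarrow> (nat \<Rightarrow> int) \<Rightarrow> (nat \<Rightarrow> int) \<Rightarrow> real" where
  "lattice_rate D q i j = (if (\<Sum>k<D. \<bar>i k - j k\<bar>) = 1 then q / (2 * real D) else 0)"

definition cartesian_bass_network ::
  "nat \<Rightarrow> real \<Rightarrow> real \<Rightarrow> 'w measure \<Rightarrow> (real \<Rightarrow> 'w \<Rightarrow> (nat \<Rightarrow> int) \<Rightarrow> bool) \<Rightarrow> bool" where
  "cartesian_bass_network D p q M X \<longleftrightarrow>
     bass_network M (lattice_nodes D) p (lattice_rate D q) X"

definition f_Bass :: "real \<Rightarrow> real \<Rightarrow> real \<Rightarrow> real" where
  "f_Bass p q t = (1 - exp (- (p + q) * t)) / (1 + q / p * exp (- (p + q) * t))"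

end

theory Submission
  imports Defs
begin

text \<open>For a finite set \<open>A\<close> of nodes let \<open>S\<^sub>A(t)\<close> be the probability that \<open>A\<close> contains no adopter
  at time \<open>t\<close>. The martingale problem applied to the indicator of this event gives the closed
  hierarchy \<open>S\<^sub>A' = - p |A| S\<^sub>A - q/(2D) \<Sum> (S\<^sub>A - S\<^bsub>A \<union> {m}\<^esub>)\<close>, summed over \<open>a \<in> A\<close> and the
  neighbours \<open>m\<close> of \<open>a\<close>. The powers \<open>(1 - f_Bass)\<^sup>n\<close> solve a hierarchy of the same form, with
  successors \<open>n \<mapsto> n + 1\<close>. Iterating the integral equations yields Taylor expansions with
  explicit remainders, and the dimension first enters at order \<open>t\<^sup>3\<close>, through the rate
  \<open>2 q - q/D\<close> at which a pair of neighbours feels the nodes outside the pair (\<open>2 q\<close> for the Bass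
  model): it contributes \<open>- p q\<^sup>2 t\<^sup>3/(6 D)\<close> to the adopter fraction.\<close>

section \<open>The abstract hierarchy and its Taylor expansion at time 0\<close>

text \<open>The index \<open>x\<close> stands for a finite node set or for an exponent and
  \<open>N x\<close> for its size; \<open>J x\<close> labels the possible enlargements with
  multiplicity, and \<open>\<tau> x y\<close> is the enlarged index. Minus this operator is the
  right-hand side of the hierarchy of differential equations.\<close>

definition hierarchy_op ::
  "real \<Rightarrow> real \<Rightarrow> ('a \<Rightarrow> nat) \<Rightarrow> ('a \<Rightarrow> 'b set) \<Rightarrow> ('a \<Rightarrow> 'b \<Rightarrow> 'a) \<Rightarrow> ('a \<Rightarrow> real) \<Rightarrow> 'a \<Rightarrow> real" where
  "hierarchy_op p c N J \<tau> s x = p * real (N x) * s x + c * (\<Sum>y\<in>J x. s x - s (\<tau> x y))"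

text \<open>The equations are posed in integrated form, which is what Fubini delivers for the
  particle system without any differentiability argument; at \<open>t = 0\<close> they also encode
  the initial value 1. Through \<open>total_rate\<close> the estimates depend on \<open>p\<close>
  and \<open>q\<close> only, not on \<open>c\<close> or the dimension.\<close>

locale hierarchy =
  fixes p q c :: real and I :: "'a set" and N :: "'a \<Rightarrow> nat"
    and J :: "'a \<Rightarrow> 'b set" and \<tau> :: "'a \<Rightarrow> 'b \<Rightarrow> 'a" and S :: "'a \<Rightarrow> real \<Rightarrow> real"
  assumes p_nonneg: "0 \<le> p" and q_nonneg: "0 \<le> q" and c_nonneg: "0 \<le> c"
    and total_rate: "\<And>x. x \<in> I \<Longrightarrow> c * real (card (J x)) = q * real (N x)"
    and successor_closed: "\<And>x y. x \<in> I \<Longrightarrow> y \<in> J x \<Longrightarrow> \<tau> x y \<in> I"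
    and successor_size: "\<And>x y. x \<in> I \<Longrightarrow> y \<in> J x \<Longrightarrow> N (\<tau> x y) \<le> Suc (N x)"
    and bounded_by_one: "\<And>x t. x \<in> I \<Longrightarrow> 0 \<le> t \<Longrightarrow> \<bar>S x t\<bar> \<le> 1"
    and integral_equation: "\<And>x t. x \<in> I \<Longrightarrow> 0 \<le> t \<Longrightarrow>
      ((\<lambda>u. hierarchy_op p c N J \<tau> (\<lambda>y. S y u) x) has_integral (1 - S x t)) {0..t}"
begin

text \<open>The Taylor coefficients at time 0, obtained by inserting a power series with constant
  term 1 into the hierarchy and comparing powers of \<open>t\<close>.\<close>

primrec coeff :: "nat \<Rightarrow> 'a \<Rightarrow> real" where
  "coeff 0 = (\<lambda>x. 1)"
| "coeff (Suc k) = (\<lambda>x. - hierarchy_op p c N J \<tau> (coeff k) x / real (Suc k))"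

lemma hierarchy_op_diff:
  "hierarchy_op p c N J \<tau> (\<lambda>y. f y - g y) x =
     hierarchy_op p c N J \<tau> f x - hierarchy_op p c N J \<tau> g x"
proof -
  have "(\<Sum>y\<in>J x. f x - g x - (f (\<tau> x y) - g (\<tau> x y)))
      = (\<Sum>y\<in>J x. f x - f (\<tau> x y)) - (\<Sum>y\<in>J x. g x - g (\<tau> x y))"
    unfolding sum_subtractf by simp
  then show ?thesis by (simp add: hierarchy_op_def right_diff_distrib)
qed

lemma hierarchy_op_sum:
  "hierarchy_op p c N J \<tau> (\<lambda>y. \<Sum>k\<in>K. f k y * a k) x =
     (\<Sum>k\<in>K. hierarchy_op p c N J \<tau> (f k) x * a k)"
proof -
  have "(\<Sum>y\<in>J x. (\<Sum>k\<in>K. f k x * a k) - (\<Sum>k\<in>K. f k (\<tau> x y) * a k))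
      = (\<Sum>k\<in>K. (\<Sum>y\<in>J x. f k x - f k (\<tau> x y)) * a k)"
    unfolding sum_subtractf[symmetric] left_diff_distrib[symmetric] sum_distrib_right
    by (rule sum.swap)
  then show ?thesis
    by (simp add: hierarchy_op_def sum_distrib_left[where A=K] sum.distrib distrib_right mult.assoc)
qed

text \<open>Each difference costs at most \<open>2 * B\<close>, and \<open>total_rate\<close> turns
  \<open>c\<close> times the number of differences into \<open>q * N x\<close>.\<close>

lemma hierarchy_op_bound:
  assumes x: "x \<in> I" and "\<bar>f x\<bar> \<le> B" and "\<And>y. y \<in> J x \<Longrightarrow> \<bar>f (\<tau> x y)\<bar> \<le> B"
  shows "\<bar>hierarchy_op p c N J \<tau> f x\<bar> \<le> real (N x) * (p + 2 * q) * B"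
proof -
  have "\<bar>\<Sum>y\<in>J x. f x - f (\<tau> x y)\<bar> \<le> (\<Sum>y\<in>J x. \<bar>f x - f (\<tau> x y)\<bar>)"
    by (rule sum_abs)
  also have "\<dots> \<le> real (card (J x)) * (2 * B)"
    by (rule sum_bounded_above) (use assms in \<open>fastforce\<close>)
  finally have "\<bar>c * (\<Sum>y\<in>J x. f x - f (\<tau> x y))\<bar> \<le> c * (real (card (J x)) * (2 * B))"
    using c_nonneg by (simp add: abs_mult mult_left_mono)
  also have "\<dots> = q * real (N x) * (2 * B)"
    using total_rate[OF x] by (metis mult.assoc)
  finally have 1: "\<bar>c * (\<Sum>y\<in>J x. f x - f (\<tau> x y))\<bar> \<le> q * real (N x) * (2 * B)" .
  have "\<bar>p * real (N x) * f x\<bar> \<le> p * real (N x) * B"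
    using p_nonneg assms(2) by (simp add: abs_mult mult_left_mono)
  with 1 have "\<bar>hierarchy_op p c N J \<tau> f x\<bar> \<le> p * real (N x) * B + q * real (N x) * (2 * B)"
    unfolding hierarchy_op_def by linarith
  then show ?thesis by (simp add: algebra_simps)
qed

text \<open>Up to sign, the remainder of order \<open>n + 1\<close> at \<open>x\<close> is the time
  integral of the operator applied to the remainders of order \<open>n\<close>. Sizes grow by at
  most one per iteration, so \<open>N x + n\<close> dominates every size met. The factorial is given
  away, since only a fixed order is used later.\<close>

lemma taylor_bound:
  assumes "x \<in> I" and "0 \<le> t"
  shows "\<bar>S x t - (\<Sum>k<n. coeff k x * t ^ k)\<bar> \<le> (real (N x + n) * (p + 2 * q)) ^ n * t ^ n"
  using assms
proof (induction n arbitrary: x t)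
  case 0
  then show ?case using bounded_by_one by simp
next
  case (Suc n)
  let ?L = "p + 2 * q"
  define r where "r u y = S y u - (\<Sum>k<n. coeff k y * u ^ k)" for u y
  have L: "0 \<le> ?L" using p_nonneg q_nonneg by simp
  have pow: "((\<lambda>u. u ^ k) has_integral t ^ Suc k / real (Suc k)) {0..t}" for k
  proof -
    have "((\<lambda>u. u ^ k) has_integral (t ^ Suc k / real (Suc k) - 0 ^ Suc k / real (Suc k))) {0..t}"
      by (rule fundamental_theorem_of_calculus[OF Suc.prems(2)])
        (auto simp flip: has_real_derivative_iff_has_vector_derivative
          intro!: derivative_eq_intros simp: divide_simps; cases k; simp add: algebra_simps)
    then show ?thesis by simp
  qed
  have "((\<lambda>u. \<Sum>k<n. hierarchy_op p c N J \<tau> (coeff k) x * u ^ k) has_integral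
      (\<Sum>k<n. hierarchy_op p c N J \<tau> (coeff k) x * (t ^ Suc k / real (Suc k)))) {0..t}"
    by (intro has_integral_sum has_integral_mult_right pow) auto
  from has_integral_diff[OF integral_equation[OF Suc.prems] this]
  have "((\<lambda>u. hierarchy_op p c N J \<tau> (r u) x) has_integral
     (1 - S x t - (\<Sum>k<n. hierarchy_op p c N J \<tau> (coeff k) x * (t ^ Suc k / real (Suc k))))) {0..t}"
    by (simp add: r_def[abs_def] hierarchy_op_diff hierarchy_op_sum)
  \<comment> \<open>The constant 1 is \<open>coeff 0 x\<close>; the shifted sum absorbs it, and the
    minus sign in \<open>coeff\<close> accounts for the rest.\<close>
  also have "1 - S x t - (\<Sum>k<n. hierarchy_op p c N J \<tau> (coeff k) x * (t ^ Suc k / real (Suc k)))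
      = - (S x t - (\<Sum>k<Suc n. coeff k x * t ^ k))"
    by (subst sum.lessThan_Suc_shift) (simp add: sum_negf)
  finally have int: "((\<lambda>u. hierarchy_op p c N J \<tau> (r u) x) has_integral
      - (S x t - (\<Sum>k<Suc n. coeff k x * t ^ k))) {0..t}" .
  let ?B = "(real (N x + Suc n) * ?L) ^ n * t ^ n"
  \<comment> \<open>A successor may be larger by one, but the remainder has order one lower:
    \<open>N y + n\<close> is at most \<open>N x + Suc n\<close>. So \<open>?B\<close> serves
    \<open>x\<close>, all its successors and all times up to \<open>t\<close> at once.\<close>
  have bound: "\<bar>r u y\<bar> \<le> ?B" if "y \<in> I" "N y \<le> Suc (N x)" "0 \<le> u" "u \<le> t" for u y
  proof -
    have "\<bar>r u y\<bar> \<le> (real (N y + n) * ?L) ^ n * u ^ n"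
      using Suc.IH[OF that(1,3)] by (simp add: r_def)
    also have "\<dots> \<le> ?B"
      using that L by (intro mult_mono power_mono mult_right_mono) auto
    finally show ?thesis .
  qed
  have "\<bar>hierarchy_op p c N J \<tau> (r u) x\<bar> \<le> real (N x) * ?L * ?B" if "u \<in> {0..t}" for u
    using that Suc.prems successor_closed successor_size
    by (intro hierarchy_op_bound bound) auto
  then have "\<bar>S x t - (\<Sum>k<Suc n. coeff k x * t ^ k)\<bar> \<le> real (N x) * ?L * ?B * t"
    using has_integral_bound_real[OF _ finite.emptyI, of "real (N x) * ?L * ?B", OF _ int] L Suc.prems(2)
    by (simp add: abs_minus_commute)
  \<comment> \<open>Enlarging \<open>N x\<close> to the base occurring in \<open>?B\<close>
    completes the power with exponent \<open>Suc n\<close>.\<close>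
  also have "\<dots> \<le> real (N x + Suc n) * ?L * ?B * t"
    using L Suc.prems(2) by (intro mult_right_mono) auto
  finally show ?case by (simp add: algebra_simps)
qed

text \<open>\<open>P\<close> is the rate at which the size grows out of an index of size 2. It is
  the only quantity through which different models with the same \<open>p\<close> and
  \<open>q\<close> differ up to order 3.\<close>

lemma expansion:
  assumes x: "x \<in> I" and t: "0 \<le> t" and Nx: "N x = 1"
    and N1: "\<And>y. y \<in> J x \<Longrightarrow> N (\<tau> x y) = 2"
    and N2: "\<And>y. y \<in> J x \<Longrightarrow>
      c * (\<Sum>z\<in>J (\<tau> x y). real (N (\<tau> (\<tau> x y) z)) - 2) = P"
  shows "\<bar>S x t - (1 - p * t + (p\<^sup>2 - p * q) / 2 * t ^ 2
            - ((p + q) * (p\<^sup>2 - p * q) - q * (4 * p\<^sup>2 - p * P)) / 6 * t ^ 3)\<bar>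
         \<le> (5 * (p + 2 * q)) ^ 4 * t ^ 4"
proof -
  have cJ: "c * real (card (J x)) = q" using total_rate[OF x] Nx by simp
  have c1: "coeff 1 y = - p * real (N y)" for y
    by (simp add: hierarchy_op_def)
  \<comment> \<open>Stated for arbitrary \<open>y\<close>, because \<open>coeff 3 x\<close> involves
    \<open>coeff 2\<close> at \<open>x\<close> and at its successors. Since \<open>coeff 1\<close>
    is linear in the size, the inner sum is the growth rate of the size: \<open>q\<close> at
    \<open>x\<close>, and \<open>P\<close> at a successor.\<close>
  have c2: "coeff 2 y = (p\<^sup>2 * (real (N y))\<^sup>2
      - p * (c * (\<Sum>z\<in>J y. real (N (\<tau> y z)) - real (N y)))) / 2" for y
  proof -
    have "coeff 2 y = - hierarchy_op p c N J \<tau> (coeff 1) y / 2"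
      by (simp add: numeral_2_eq_2)
    also have "hierarchy_op p c N J \<tau> (coeff 1) y = - p\<^sup>2 * (real (N y))\<^sup>2
        + c * (\<Sum>z\<in>J y. p * (real (N (\<tau> y z)) - real (N y)))"
      unfolding hierarchy_op_def c1 by (simp add: power2_eq_square algebra_simps)
    finally show ?thesis
      unfolding sum_distrib_left[symmetric] by (simp only: mult.left_commute[of c p]) simp
  qed
  have c2x: "coeff 2 x = (p\<^sup>2 - p * q) / 2"
    using cJ by (simp add: c2 Nx N1)
  have c2y: "coeff 2 (\<tau> x y) = (4 * p\<^sup>2 - p * P) / 2" if "y \<in> J x" for y
    using N2[OF that] by (simp add: c2 N1[OF that])
  have "coeff 3 x = - hierarchy_op p c N J \<tau> (coeff 2) x / 3"
    by (simp add: numeral_3_eq_3 numeral_2_eq_2)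
  also have "hierarchy_op p c N J \<tau> (coeff 2) x = p * ((p\<^sup>2 - p * q) / 2) +
      (c * real (card (J x))) * ((p\<^sup>2 - p * q) / 2 - (4 * p\<^sup>2 - p * P) / 2)"
  proof -
    have "(\<Sum>y\<in>J x. coeff 2 x - coeff 2 (\<tau> x y))
        = (\<Sum>y\<in>J x. (p\<^sup>2 - p * q) / 2 - (4 * p\<^sup>2 - p * P) / 2)"
      by (rule sum.cong) (simp_all only: c2x c2y)
    then show ?thesis unfolding hierarchy_op_def by (simp add: Nx c2x)
  qed
  finally have c3: "coeff 3 x = - ((p + q) * (p\<^sup>2 - p * q) - q * (4 * p\<^sup>2 - p * P)) / 6"
    unfolding cJ by (simp add: field_simps)
  have "(\<Sum>k<4. coeff k x * t ^ k) =
      coeff 0 x + coeff 1 x * t + coeff 2 x * t ^ 2 + coeff 3 x * t ^ 3"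
    by (simp add: eval_nat_numeral)
  also have "\<dots> = 1 - p * t + (p\<^sup>2 - p * q) / 2 * t ^ 2
            - ((p + q) * (p\<^sup>2 - p * q) - q * (4 * p\<^sup>2 - p * P)) / 6 * t ^ 3"
    unfolding c3 c2x c1 Nx by (simp add: field_simps)
  \<comment> \<open>The 5 in the error bound is \<open>N x + 4\<close> with
    \<open>N x = 1\<close>.\<close>
  finally show ?thesis
    using taylor_bound[OF x t, of 4] Nx by simp
qed

end

section \<open>The Bass model as a hierarchy\<close>

text \<open>The nonadopter fraction \<open>s\<close> solves
  \<open>s' = - (p * s + q * (s - s ^ 2))\<close>, so its powers form a hierarchy with
  \<open>c = q\<close> in which exponent \<open>n\<close> has \<open>n\<close> successors, all equal
  to \<open>n + 1\<close>.\<close>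

lemma f_Bass_expansion:
  assumes p: "0 < p" and q: "0 < q" and t: "0 \<le> t"
  shows "\<bar>1 - f_Bass p q t - (1 - p * t + (p\<^sup>2 - p * q) / 2 * t ^ 2
            - ((p + q) * (p\<^sup>2 - p * q) - q * (4 * p\<^sup>2 - p * (2 * q))) / 6 * t ^ 3)\<bar>
         \<le> (5 * (p + 2 * q)) ^ 4 * t ^ 4"
proof -
  define s where "s u = 1 - f_Bass p q u" for u
  have s_eq: "s u = (p + q) * exp (- (p + q) * u) / (p + q * exp (- (p + q) * u))" for u
  proof -
    have "p + q * exp (- (p + q) * u) > 0" using p q by (simp add: add_pos_pos)
    then show ?thesis using p by (simp add: s_def f_Bass_def field_simps)
  qed
  have deriv: "(s has_real_derivative - (p * s u + q * (s u - s u ^ 2))) (at u)" for u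
  proof -
    have pos: "p + q * exp (- (p + q) * u) > 0" using p q by (simp add: add_pos_pos)
    define e where "e = exp (- (p + q) * u)"
    have "(s has_real_derivative
       ((p + q) * (exp (- (p + q) * u) * (- (p + q))) * (p + q * exp (- (p + q) * u))
        - (p + q) * exp (- (p + q) * u) * (q * (exp (- (p + q) * u) * (- (p + q)))))
        / (p + q * exp (- (p + q) * u)) ^ 2) (at u)"
      unfolding s_eq[abs_def] using pos
      by (auto intro!: derivative_eq_intros simp: power2_eq_square)
    also have "((p + q) * (exp (- (p + q) * u) * (- (p + q))) * (p + q * exp (- (p + q) * u))
        - (p + q) * exp (- (p + q) * u) * (q * (exp (- (p + q) * u) * (- (p + q)))))
        / (p + q * exp (- (p + q) * u)) ^ 2 = - (p * s u + q * (s u - s u ^ 2))"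
      using pos unfolding s_eq e_def[symmetric]
      by (simp add: divide_simps) (simp add: algebra_simps power2_eq_square power3_eq_cube)
    finally show ?thesis .
  qed
  have s_le: "0 \<le> s u \<and> s u \<le> 1" if "0 \<le> u" for u
  proof -
    have "- (p + q) * u \<le> 0" using p q that by (intro mult_nonpos_nonneg) auto
    then have "exp (- (p + q) * u) \<le> 1" by (simp only: exp_le_one_iff)
    moreover have "p + q * exp (- (p + q) * u) > 0" using p q by (simp add: add_pos_pos)
    ultimately show ?thesis
      unfolding s_eq using p q by (simp add: field_simps)
  qed
  have s0: "s 0 = 1" by (simp add: s_def f_Bass_def)
  interpret hierarchy p q q UNIV "\<lambda>n. n" "\<lambda>n. {..<n}" "\<lambda>n _. Suc n" "\<lambda>n u. s u ^ n"
  proof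
    fix n :: nat and t :: real assume t: "0 \<le> t"
    show "\<bar>s t ^ n\<bar> \<le> 1" using s_le[OF t] by (simp add: power_le_one)
    have "((\<lambda>u. - hierarchy_op p q (\<lambda>n. n) (\<lambda>n. {..<n}) (\<lambda>n _. Suc n) (\<lambda>n. s u ^ n) n)
        has_integral (s t ^ n - s 0 ^ n)) {0..t}"
    proof (rule fundamental_theorem_of_calculus[OF t])
      fix u
      \<comment> \<open>The chain rule gives
        \<open>- n * (p * s ^ n + q * (s ^ n - s ^ Suc n))\<close>; the factor \<open>n\<close> of
        the second term is the number of labels in \<open>{..<n}\<close>.\<close>
      have "((\<lambda>u. s u ^ n) has_real_derivative
          - hierarchy_op p q (\<lambda>n. n) (\<lambda>n. {..<n}) (\<lambda>n _. Suc n) (\<lambda>n. s u ^ n) n) (at u)"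
        by (rule derivative_eq_intros refl deriv)+
          (cases n; simp add: hierarchy_op_def algebra_simps power2_eq_square)
      then show "((\<lambda>u. s u ^ n) has_vector_derivative
          - hierarchy_op p q (\<lambda>n. n) (\<lambda>n. {..<n}) (\<lambda>n _. Suc n) (\<lambda>n. s u ^ n) n)
          (at u within {0..t})"
        by (simp add: has_real_derivative_iff_has_vector_derivative has_vector_derivative_at_within)
    qed
    from has_integral_neg[OF this]
    show "((\<lambda>u. hierarchy_op p q (\<lambda>n. n) (\<lambda>n. {..<n}) (\<lambda>n _. Suc n) (\<lambda>n. s u ^ n) n)
        has_integral (1 - s t ^ n)) {0..t}"
      by (simp add: s0)
  qed (use p q in auto)
  \<comment> \<open>Exponent 2 has two successors of size 3, each at rate \<open>q\<close>, whence
    \<open>P = 2 * q\<close>.\<close>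
  show ?thesis
    using expansion[OF _ t, of 1 "2 * q"] by (simp add: s_def)
qed

section \<open>From the martingale problem to the integral equations\<close>

definition no_adopters :: "'v set \<Rightarrow> ('v \<Rightarrow> bool) \<Rightarrow> real" where
  "no_adopters A \<eta> = of_bool (\<forall>a\<in>A. \<not> \<eta> a)"

text \<open>Pairs \<open>(a, m)\<close> with \<open>m \<in> A\<close> contribute \<open>0\<close>, so edges inside \<open>A\<close> need not be excluded.\<close>

lemma bass_generator_no_adopters:
  assumes A: "finite A" "A \<subseteq> V"
    and nb: "\<And>j. j \<in> V \<Longrightarrow> finite (nb j)" "\<And>j. j \<in> V \<Longrightarrow> nb j \<subseteq> V - {j}"
    and Q: "\<And>k j. k \<in> V \<Longrightarrow> j \<in> V \<Longrightarrow> Q k j = (if k \<in> nb j then c else 0)"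
  shows "bass_generator V p Q (no_adopters A) \<eta> =
    - hierarchy_op p c card (\<lambda>A. Sigma A nb) (\<lambda>A am. insert (snd am) A) (\<lambda>B. no_adopters B \<eta>) A"
proof -
  let ?g = "no_adopters A"
  have rate: "adoption_rate V p Q \<eta> j = p + (\<Sum>m\<in>nb j. c * of_bool (\<eta> m))" if "j \<in> V" for j
  proof -
    have "infsum (\<lambda>k. Q k j * of_bool (\<eta> k)) (V - {j}) = infsum (\<lambda>k. c * of_bool (\<eta> k)) (nb j)"
      by (rule infsum_cong_neutral) (use nb(2)[OF that] Q that in auto)
    then show ?thesis by (simp add: adoption_rate_def nb(1)[OF that])
  qed
  have "bass_generator V p Q ?g \<eta> =
      infsum (\<lambda>j. of_bool (\<not> \<eta> j) * adoption_rate V p Q \<eta> j * (?g (\<eta>(j := True)) - ?g \<eta>)) A"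
    unfolding bass_generator_def
    by (rule infsum_cong_neutral) (use A in \<open>auto simp: no_adopters_def\<close>)
  also have "\<dots> = (\<Sum>j\<in>A. - (p * ?g \<eta> + c * (\<Sum>m\<in>nb j. ?g \<eta> - no_adopters (insert m A) \<eta>)))"
    unfolding infsum_finite[OF A(1)]
  proof (rule sum.cong)
    fix j assume j: "j \<in> A"
    then have g: "?g (\<eta>(j := True)) = 0" by (auto simp: no_adopters_def)
    \<comment> \<open>This identity closes the hierarchy: influence by an adopter at
      \<open>m\<close> becomes a difference of two indicators of the same kind.\<close>
    have m: "?g \<eta> - no_adopters (insert m A) \<eta> = of_bool (\<eta> m) * ?g \<eta>" for m
      by (auto simp: no_adopters_def)
    have "of_bool (\<not> \<eta> j) * ?g \<eta> = ?g \<eta>" using j by (auto simp: no_adopters_def)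
    then show "of_bool (\<not> \<eta> j) * adoption_rate V p Q \<eta> j * (?g (\<eta>(j := True)) - ?g \<eta>)
        = - (p * ?g \<eta> + c * (\<Sum>m\<in>nb j. ?g \<eta> - no_adopters (insert m A) \<eta>))"
      using rate[of j] j A(2) unfolding m g
      by (auto simp: sum_distrib_right[symmetric] sum_distrib_left[symmetric] algebra_simps)
  qed simp
  also have "\<dots> = - (p * card A * ?g \<eta>
      + c * (\<Sum>j\<in>A. \<Sum>m\<in>nb j. ?g \<eta> - no_adopters (insert m A) \<eta>))"
    unfolding sum_negf sum.distrib sum_distrib_left[symmetric] by simp
  also have "(\<Sum>j\<in>A. \<Sum>m\<in>nb j. ?g \<eta> - no_adopters (insert m A) \<eta>)
      = (\<Sum>am\<in>Sigma A nb. ?g \<eta> - no_adopters (insert (snd am) A) \<eta>)"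
    using A nb(1) by (subst sum.Sigma) (auto simp: split_beta)
  also have "- (p * card A * ?g \<eta> + c * \<dots>) = - hierarchy_op p c card (\<lambda>A. Sigma A nb)
      (\<lambda>A am. insert (snd am) A) (\<lambda>B. no_adopters B \<eta>) A"
    unfolding hierarchy_op_def ..
  finally show ?thesis .
qed

lemma (in bass_network) measurable_no_adopters:
  assumes "finite A" "A \<subseteq> V" "0 \<le> t"
  shows "(\<lambda>\<omega>. no_adopters A (X t \<omega>)) \<in> borel_measurable M"
proof -
  have [measurable]: "Measurable.pred M (\<lambda>\<omega>. X t \<omega> a)" if "a \<in> A" for a
    using state_measurable assms that by auto
  have "Measurable.pred M (\<lambda>\<omega>. \<forall>a\<in>A. \<not> X t \<omega> a)"
    using assms(1) by measurable
  then show ?thesis unfolding no_adopters_def by measurable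
qed

text \<open>Right continuity and monotonicity reduce the condition to countably many times, which
  gives joint measurability.\<close>

lemma (in bass_network) adopter_iff_rational:
  assumes "0 \<le> u" "j \<in> V" "\<omega> \<in> space M"
  shows "X u \<omega> j \<longleftrightarrow> (\<forall>r. 0 \<le> r \<longrightarrow> real_of_rat r \<le> u \<or> X (real_of_rat r) \<omega> j)"
proof
  assume "X u \<omega> j"
  then show "\<forall>r. 0 \<le> r \<longrightarrow> real_of_rat r \<le> u \<or> X (real_of_rat r) \<omega> j"
    using adopters_remain[OF assms(1) _ assms(2,3)] by (meson linear)
next
  assume *: "\<forall>r. 0 \<le> r \<longrightarrow> real_of_rat r \<le> u \<or> X (real_of_rat r) \<omega> j"
  obtain b where b: "u < b" "\<And>v. u < v \<Longrightarrow> v < b \<Longrightarrow> X v \<omega> j = X u \<omega> j"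
    using right_continuous[OF assms] unfolding eventually_at_right_field by auto
  obtain r where r: "u < real_of_rat r" "real_of_rat r < b"
    using of_rat_dense[OF b(1)] by auto
  then have "0 \<le> r" using assms(1) by (metis less_eq_real_def less_le_trans zero_le_of_rat_iff order_trans)
  with * r b(2) show "X u \<omega> j" by (metis not_le)
qed

text \<open>Joint measurability is required for Fubini. The cutoff removes negative times, where
  nothing is assumed about \<open>X\<close>.\<close>

lemma (in bass_network) measurable_no_adopters_pair:
  fixes t :: real
  assumes "finite A" "A \<subseteq> V"
  shows "(\<lambda>(u, \<omega>). indicator {0..t} u * no_adopters A (X u \<omega>))
    \<in> borel_measurable (lborel \<Otimes>\<^sub>M M)"
proof -
  let ?P = "\<lambda>(z :: real \<times> 'w) j. \<forall>r. 0 \<le> r \<longrightarrow> real_of_rat r \<le> fst z \<or> X (real_of_rat r) (snd z) j"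
  have [measurable]: "Measurable.pred M (\<lambda>\<omega>. X (real_of_rat r) \<omega> j)"
    if "0 \<le> r" "j \<in> V" for r j
    using state_measurable that by auto
  have 1: "Measurable.pred (lborel \<Otimes>\<^sub>M M) (\<lambda>z. ?P z j)" if "j \<in> V" for j
  proof (intro pred_intros_countable)
    fix r :: rat
    show "Measurable.pred (lborel \<Otimes>\<^sub>M M)
      (\<lambda>z. 0 \<le> r \<longrightarrow> real_of_rat r \<le> fst z \<or> X (real_of_rat r) (snd z) j)"
      using that by (cases "0 \<le> r") auto
  qed
  have 2: "Measurable.pred (lborel \<Otimes>\<^sub>M M) (\<lambda>z. \<forall>j\<in>A. \<not> ?P z j)"
    using assms by (intro pred_intros_finite pred_intros_logic 1) auto
  have "(\<lambda>z. indicator {0..t} (fst z) * of_bool (\<forall>j\<in>A. \<not> ?P z j) :: real)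
      \<in> borel_measurable (lborel \<Otimes>\<^sub>M M)"
    using 2 by measurable
  also have "?this \<longleftrightarrow> ?thesis"
  proof (rule measurable_cong)
    fix z :: "real \<times> 'w" assume z: "z \<in> space (lborel \<Otimes>\<^sub>M M)"
    obtain u \<omega> where u: "z = (u, \<omega>)" by force
    have "X u \<omega> j \<longleftrightarrow> ?P z j" if "0 \<le> u" "j \<in> A" for j
      unfolding u fst_conv snd_conv using that z assms(2)
      by (intro adopter_iff_rational) (auto simp: u space_pair_measure)
    then show "indicator {0..t} (fst z) * of_bool (\<forall>j\<in>A. \<not> ?P z j) =
      (case z of (u, \<omega>) \<Rightarrow> indicator {0..t} u * no_adopters A (X u \<omega>))"
      by (auto simp: u no_adopters_def indicator_def)
  qed
  finally show ?thesis .
qed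

lemma (in bass_network) integrable_no_adopters_pair:
  fixes t :: real
  assumes "finite A" "A \<subseteq> V"
  shows "integrable (lborel \<Otimes>\<^sub>M M) (\<lambda>(u, \<omega>). indicator {0..t} u * no_adopters A (X u \<omega>))"
proof (rule Bochner_Integration.integrable_bound)
  have "emeasure (lborel \<Otimes>\<^sub>M M) ({0..t} \<times> space M) = emeasure lborel {0..t} * emeasure M (space M)"
    by (rule emeasure_pair_measure_Times) auto
  then show "integrable (lborel \<Otimes>\<^sub>M M) (indicator ({0..t} \<times> space M) :: _ \<Rightarrow> real)"
    by (intro integrable_real_indicator) (auto simp: emeasure_space_1 emeasure_lborel_Icc_eq)
  show "AE x in lborel \<Otimes>\<^sub>M M. norm (case x of (u, \<omega>) \<Rightarrow> indicator {0..t} u * no_adopters A (X u \<omega>))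
      \<le> norm (indicator ({0..t} \<times> space M) x :: real)"
    by (rule AE_I2) (auto simp: no_adopters_def indicator_def space_pair_measure)
qed (rule measurable_no_adopters_pair[OF assms])

text \<open>The martingale identity between times 0 and \<open>t\<close> is integrated over
  \<open>M\<close>; Fubini then exchanges expectation and time integral. As the generator yields
  minus the operator, the compensator in \<open>dynkin_process\<close> enters with a plus
  sign.\<close>

lemma (in bass_network) integral_equation_no_adopters:
  assumes A: "finite A" "A \<subseteq> V" and t: "0 \<le> t"
    and nb: "\<And>j. j \<in> V \<Longrightarrow> finite (nb j)" "\<And>j. j \<in> V \<Longrightarrow> nb j \<subseteq> V - {j}"
    and Q: "\<And>k j. k \<in> V \<Longrightarrow> j \<in> V \<Longrightarrow> Q k j = (if k \<in> nb j then c else 0)"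
  shows "((\<lambda>u. hierarchy_op p c card (\<lambda>A. Sigma A nb) (\<lambda>A am. insert (snd am) A)
        (\<lambda>B. expectation (\<lambda>\<omega>. no_adopters B (X u \<omega>))) A)
      has_integral (1 - expectation (\<lambda>\<omega>. no_adopters A (X t \<omega>)))) {0..t}"
proof -
  interpret pair_sigma_finite lborel M ..
  let ?op = "hierarchy_op p c card (\<lambda>A. Sigma A nb) (\<lambda>A am. insert (snd am) A)"
  let ?g = "no_adopters A"
  let ?f = "\<lambda>u \<omega>. indicator {0..t} u * ?op (\<lambda>B. no_adopters B (X u \<omega>)) A"
  have succ: "finite (insert (snd am) A) \<and> insert (snd am) A \<subseteq> V" if "am \<in> Sigma A nb" for am
    using A nb(2) that by fastforce
  have gen: "bass_generator V p Q ?g \<eta> = - ?op (\<lambda>B. no_adopters B \<eta>) A" for \<eta>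
    by (rule bass_generator_no_adopters[OF A nb Q])
  \<comment> \<open>The cutoff is distributed over the terms, so that each has the form covered by
    \<open>integrable_no_adopters_pair\<close>.\<close>
  have f_eq: "?f u \<omega> = p * real (card A) * (indicator {0..t} u * no_adopters A (X u \<omega>))
      + c * (\<Sum>am\<in>Sigma A nb. indicator {0..t} u * no_adopters A (X u \<omega>)
          - indicator {0..t} u * no_adopters (insert (snd am) A) (X u \<omega>))" for u \<omega>
    by (auto simp: hierarchy_op_def indicator_def)
  have int_f: "integrable (lborel \<Otimes>\<^sub>M M) (\<lambda>(u, \<omega>). ?f u \<omega>)"
    unfolding f_eq split_beta'
    by (intro Bochner_Integration.integrable_add integrable_mult_right
        Bochner_Integration.integrable_sum Bochner_Integration.integrable_diff
        integrable_no_adopters_pair[unfolded split_beta'])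
      (use A succ in auto)
  have int_X: "integrable M (\<lambda>\<omega>. no_adopters B (X u \<omega>))" if "finite B" "B \<subseteq> V" "0 \<le> u" for B u
    by (rule integrable_const_bound[where B=1])
      (use measurable_no_adopters[OF that] in \<open>auto simp: no_adopters_def\<close>)
  have op_exp: "?op (\<lambda>B. expectation (\<lambda>\<omega>. no_adopters B (X u \<omega>))) A =
      expectation (\<lambda>\<omega>. ?op (\<lambda>B. no_adopters B (X u \<omega>)) A)" if "0 \<le> u" for u
    unfolding hierarchy_op_def
    using int_X[OF A that] int_X[OF _ _ that] succ
    by (simp add: Bochner_Integration.integral_sum Bochner_Integration.integral_diff)
  have dyn: "dynkin_process V p Q X ?g t \<omega> = ?g (X t \<omega>) + (\<integral>u. ?f u \<omega> \<partial>lborel)" for \<omega>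
    by (simp add: dynkin_process_def gen set_lebesgue_integral_def)
  have int_time: "integrable M (\<lambda>\<omega>. \<integral>u. ?f u \<omega> \<partial>lborel)"
    using integrable_snd[OF int_f] .
  have int_dyn: "integrable M (dynkin_process V p Q X ?g t)"
    unfolding dyn[abs_def] using int_X[OF A t] int_time by simp
  have dyn0: "dynkin_process V p Q X ?g 0 \<omega> = 1" if "\<omega> \<in> space M" for \<omega>
  proof -
    have "?g (X 0 \<omega>) = 1" using all_nonadopters_initially A(2) that by (auto simp: no_adopters_def)
    moreover have "(LINT u:{0..0}|lborel. bass_generator V p Q ?g (X u \<omega>)) = 0"
      unfolding set_lebesgue_integral_def
      by (rule integral_eq_zero_AE) (use AE_lborel_singleton[of "0::real"] in eventually_elim, simp)
    ultimately show ?thesis by (simp add: dynkin_process_def)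
  qed
  \<comment> \<open>This licenses the rule that a conditional expectation has the same mean as the
    original variable.\<close>
  have "finite_measure_subalgebra M (history M V X 0)"
  proof
    have "sets (history M V X 0) \<subseteq> sets M"
      unfolding history_def
      by (subst sets_measure_of)
        (use state_measurable in \<open>auto intro!: sets.sigma_sets_subset pred_def[THEN iffD1]\<close>)
    then show "subalgebra M (history M V X 0)"
      by (auto simp: subalgebra_def history_def space_measure_of_conv)
  qed
  then interpret H: finite_measure_subalgebra M "history M V X 0" .
  have "expectation (dynkin_process V p Q X ?g t)
      = expectation (real_cond_exp M (history M V X 0) (dynkin_process V p Q X ?g t))"
    using H.real_cond_exp_int(2)[OF int_dyn] by simp
  also have "\<dots> = expectation (\<lambda>_. 1)"
  proof (rule integral_cong_AE)
    have "depends_on A ?g" by (auto simp: depends_on_def no_adopters_def)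
    from martingale_problem[OF A this order_refl t]
    show "AE \<omega> in M. real_cond_exp M (history M V X 0) (dynkin_process V p Q X ?g t) \<omega> = 1"
      using AE_space by eventually_elim (simp add: dyn0)
  qed auto
  also have "\<dots> = 1" by (simp add: prob_space)
  finally have "expectation (\<lambda>\<omega>. ?g (X t \<omega>)) + expectation (\<lambda>\<omega>. \<integral>u. ?f u \<omega> \<partial>lborel) = 1"
    unfolding dyn[abs_def] using int_X[OF A t] int_time by simp
  then have "(\<integral>u. expectation (?f u) \<partial>lborel) = 1 - expectation (\<lambda>\<omega>. ?g (X t \<omega>))"
    using Fubini_integral[OF int_f] by simp
  moreover have "integrable lborel (\<lambda>u. expectation (?f u))"
    using integrable_fst[OF int_f] .
  \<comment> \<open>For negative \<open>u\<close>, where \<open>op_exp\<close> does not apply, both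
    sides vanish by the cutoff.\<close>
  moreover have "(\<lambda>u. expectation (?f u)) =
      (\<lambda>u. indicator {0..t} u * ?op (\<lambda>B. expectation (\<lambda>\<omega>. no_adopters B (X u \<omega>))) A)"
    using op_exp by (auto simp: indicator_def)
  ultimately have "set_integrable lborel {0..t} (\<lambda>u. ?op (\<lambda>B. expectation (\<lambda>\<omega>. no_adopters B (X u \<omega>))) A)"
      and "(LINT u:{0..t}|lborel. ?op (\<lambda>B. expectation (\<lambda>\<omega>. no_adopters B (X u \<omega>))) A)
        = 1 - expectation (\<lambda>\<omega>. ?g (X t \<omega>))"
    unfolding set_integrable_def set_lebesgue_integral_def real_scaleR_def by metis+
  then show ?thesis
    using set_borel_integral_eq_integral by (metis has_integral_integral)
qed


section \<open>Neighbourhoods in the lattice\<close>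

definition lattice_neighbours :: "nat \<Rightarrow> (nat \<Rightarrow> int) \<Rightarrow> (nat \<Rightarrow> int) set" where
  "lattice_neighbours D j = {i \<in> lattice_nodes D. (\<Sum>k<D. \<bar>i k - j k\<bar>) = 1}"

lemma lattice_neighbours_sym:
  assumes "j \<in> lattice_nodes D" "m \<in> lattice_neighbours D j"
  shows "j \<in> lattice_neighbours D m"
  using assms by (simp add: lattice_neighbours_def abs_minus_commute)

lemma lattice_neighbours_subset: "lattice_neighbours D j \<subseteq> lattice_nodes D - {j}"
  by (auto simp: lattice_neighbours_def)

text \<open>Nonnegative integers with sum 1 are all zero except for a single 1, so exactly one
  coordinate moves, by one unit. Outside \<open>{..<D}\<close> the nodes agree by
  extensionality.\<close>

lemma lattice_neighbours_eq:
  assumes j: "j \<in> lattice_nodes D"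
  shows "lattice_neighbours D j = (\<lambda>(k, s). j(k := j k + s)) ` ({..<D} \<times> {-1, 1})"
proof
  show "lattice_neighbours D j \<subseteq> (\<lambda>(k, s). j(k := j k + s)) ` ({..<D} \<times> {-1, 1})"
  proof
    fix i assume i: "i \<in> lattice_neighbours D j"
    then have sum: "(\<Sum>k<D. \<bar>i k - j k\<bar>) = 1" by (simp add: lattice_neighbours_def)
    then obtain k where k: "k < D" "i k \<noteq> j k"
      by (metis (no_types, lifting) abs_zero diff_self lessThan_iff sum.neutral zero_neq_one)
    have "(\<Sum>k<D. \<bar>i k - j k\<bar>) = \<bar>i k - j k\<bar> + (\<Sum>l\<in>{..<D} - {k}. \<bar>i l - j l\<bar>)"
      using k by (simp add: sum.remove)
    moreover have "(\<Sum>l\<in>{..<D} - {k}. \<bar>i l - j l\<bar>) \<ge> 0" by (simp add: sum_nonneg)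
    ultimately have 1: "\<bar>i k - j k\<bar> = 1" and "(\<Sum>l\<in>{..<D} - {k}. \<bar>i l - j l\<bar>) = 0"
      using sum k by linarith+
    then have eq: "i l = j l" if "l < D" "l \<noteq> k" for l
      using that by (simp add: sum_nonneg_eq_0_iff)
    have "i = j(k := j k + (i k - j k))"
    proof
      fix l
      show "i l = (j(k := j k + (i k - j k))) l"
        using eq[of l] i j k by (cases "l < D")
          (auto simp: lattice_neighbours_def lattice_nodes_def PiE_def extensional_def)
    qed
    moreover have "i k - j k \<in> {-1, 1}" using 1 by auto
    ultimately show "i \<in> (\<lambda>(k, s). j(k := j k + s)) ` ({..<D} \<times> {-1, 1})"
      using k(1) by (intro image_eqI[where x="(k, i k - j k)"]) auto
  qed
  have "j(k := j k + s) \<in> lattice_neighbours D j" if "k < D" "\<bar>s\<bar> = 1" for k s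
  proof -
    have "(\<Sum>l<D. \<bar>(j(k := j k + s)) l - j l\<bar>) = (\<Sum>l<D. if l = k then 1 else 0)"
      using that(2) by (intro sum.cong) auto
    then show ?thesis
      using that(1) j
      by (auto simp: lattice_neighbours_def lattice_nodes_def PiE_def extensional_def)
  qed
  then show "(\<lambda>(k, s). j(k := j k + s)) ` ({..<D} \<times> {-1, 1}) \<subseteq> lattice_neighbours D j"
    by (auto simp del: add_uminus_conv_diff)
qed

lemma finite_lattice_neighbours: "j \<in> lattice_nodes D \<Longrightarrow> finite (lattice_neighbours D j)"
  by (simp add: lattice_neighbours_eq)

lemma card_lattice_neighbours:
  assumes "j \<in> lattice_nodes D"
  shows "card (lattice_neighbours D j) = 2 * D"
proof -
  have "inj_on (\<lambda>(k, s). j(k := j k + s)) ({..<D} \<times> {-1, 1})"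
  proof (rule inj_onI, clarify)
    fix k l s r assume s: "s \<in> {-1, 1::int}" "r \<in> {-1, 1::int}"
      and eq: "j(k := j k + s) = j(l := j l + r)"
    from fun_cong[OF eq, of k] fun_cong[OF eq, of l] s
    show "k = l \<and> s = r" by (auto split: if_splits)
  qed
  then show ?thesis
    by (simp add: lattice_neighbours_eq[OF assms] card_image card_cartesian_product)
qed

text \<open>Each node of a neighbouring pair has \<open>2 * D\<close> neighbours, one of which is
  its partner. Thus \<open>2 * (2 * D - 1)\<close> edges leave the pair, each at rate
  \<open>q / (2 * D)\<close>, which gives \<open>P = 2 * q - q / D\<close>.\<close>

lemma cartesian_expansion:
  assumes net: "cartesian_bass_network D p q M X" and p: "0 < p" and q: "0 < q"
    and D: "1 \<le> D" and j: "j \<in> lattice_nodes D" and t: "0 \<le> t"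
  shows "\<bar>1 - \<P>(\<omega> in M. X t \<omega> j) - (1 - p * t + (p\<^sup>2 - p * q) / 2 * t ^ 2
            - ((p + q) * (p\<^sup>2 - p * q) - q * (4 * p\<^sup>2 - p * (2 * q - q / D))) / 6 * t ^ 3)\<bar>
         \<le> (5 * (p + 2 * q)) ^ 4 * t ^ 4"
proof -
  let ?V = "lattice_nodes D" and ?nb = "lattice_neighbours D"
  let ?c = "q / (2 * real D)"
  interpret bass_network M ?V p "lattice_rate D q" X
    using net by (simp add: cartesian_bass_network_def)
  have Q: "lattice_rate D q k i = (if k \<in> ?nb i then ?c else 0)" if "k \<in> ?V" for k i
    using that by (simp add: lattice_rate_def lattice_neighbours_def)
  interpret hierarchy p q ?c "{A. finite A \<and> A \<subseteq> ?V}" card "\<lambda>A. Sigma A ?nb"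
    "\<lambda>A am. insert (snd am) A" "\<lambda>A t. expectation (\<lambda>\<omega>. no_adopters A (X t \<omega>))"
  proof
    fix A t assume A: "A \<in> {A. finite A \<and> A \<subseteq> ?V}"
    have "card (Sigma A ?nb) = (\<Sum>a\<in>A. card (?nb a))"
      using A finite_lattice_neighbours by (intro card_SigmaI) auto
    also have "\<dots> = (\<Sum>a\<in>A. 2 * D)"
      using A card_lattice_neighbours by (intro sum.cong) auto
    finally show "?c * real (card (Sigma A ?nb)) = q * real (card A)"
      using D by simp
    assume t: "(0::real) \<le> t"
    have "\<bar>expectation (\<lambda>\<omega>. no_adopters A (X t \<omega>))\<bar>
        \<le> expectation (\<lambda>\<omega>. \<bar>no_adopters A (X t \<omega>)\<bar>)"
      by (rule integral_abs_bound)
    also have "\<dots> \<le> 1"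
      using measurable_no_adopters[of A t] A t
      by (intro integral_le_const integrable_const_bound[where B=1])
        (auto simp: no_adopters_def)
    finally show "\<bar>expectation (\<lambda>\<omega>. no_adopters A (X t \<omega>))\<bar> \<le> 1" .
    show "((\<lambda>u. hierarchy_op p ?c card (\<lambda>A. Sigma A ?nb) (\<lambda>A am. insert (snd am) A)
        (\<lambda>B. expectation (\<lambda>\<omega>. no_adopters B (X u \<omega>))) A)
      has_integral (1 - expectation (\<lambda>\<omega>. no_adopters A (X t \<omega>)))) {0..t}"
      using A t
      by (intro integral_equation_no_adopters finite_lattice_neighbours lattice_neighbours_subset Q)
        auto
  next
    fix A am assume "A \<in> {A. finite A \<and> A \<subseteq> ?V}" "am \<in> Sigma A ?nb"
    then show "insert (snd am) A \<in> {A. finite A \<and> A \<subseteq> ?V}"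
      and "card (insert (snd am) A) \<le> Suc (card A)"
      using lattice_neighbours_subset by (fastforce simp: card_insert_if)+
  qed (use p q in auto)
  have pair: "?c * (\<Sum>z\<in>Sigma (insert m {j}) ?nb. real (card (insert (snd z) (insert m {j}))) - 2)
      = 2 * q - q / D" if m: "m \<in> ?nb j" for m
  proof -
    have ne: "m \<noteq> j" "m \<in> ?V" using m lattice_neighbours_subset by auto
    \<comment> \<open>Here \<open>a'\<close> is the partner of \<open>a\<close>. Adding a neighbour
      \<open>b\<close> of \<open>a\<close> enlarges the pair unless \<open>b = a'\<close>; the case
      \<open>b = a\<close> is excluded, as no node neighbours itself.\<close>
    have gain: "(\<Sum>b\<in>?nb a. real (card (insert b {m, j})) - 2) = 2 * real D - 1"
      if a: "a \<in> ?V" "a' \<in> ?nb a" "{a, a'} = {m, j}" for a a'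
    proof -
      have "a \<notin> ?nb a" using lattice_neighbours_subset by auto
      then have "(\<Sum>b\<in>?nb a. real (card (insert b {m, j})) - 2)
          = (\<Sum>b\<in>?nb a. if b = a' then 0 else 1)"
        using ne a(3) by (intro sum.cong) (auto simp: card_insert_if doubleton_eq_iff)
      also have "\<dots> = (\<Sum>b\<in>?nb a. 1 - of_bool (b = a'))"
        by (intro sum.cong) auto
      also have "\<dots> = 2 * real D - 1"
        using a finite_lattice_neighbours card_lattice_neighbours
        by (simp add: sum_subtractf of_bool_def)
      finally show ?thesis .
    qed
    have "(\<Sum>z\<in>Sigma {m, j} ?nb. real (card (insert (snd z) {m, j})) - 2)
        = (\<Sum>a\<in>{m, j}. \<Sum>b\<in>?nb a. real (card (insert b {m, j})) - 2)"
      using ne j finite_lattice_neighbours by (subst sum.Sigma) (auto simp: split_beta)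
    also have "\<dots> = 2 * (2 * real D - 1)"
      using ne gain[of m j] gain[of j m] j m lattice_neighbours_sym[OF j m]
      by (simp add: insert_commute)
    finally have sum: "(\<Sum>z\<in>Sigma {m, j} ?nb. real (card (insert (snd z) {m, j})) - 2)
        = 2 * (2 * real D - 1)" .
    show ?thesis unfolding sum using D by (simp add: field_simps)
  qed
  have "expectation (\<lambda>\<omega>. no_adopters {j} (X t \<omega>)) = 1 - \<P>(\<omega> in M. X t \<omega> j)"
  proof -
    have [measurable]: "Measurable.pred M (\<lambda>\<omega>. X t \<omega> j)"
      using state_measurable[OF t j] .
    have "expectation (\<lambda>\<omega>. no_adopters {j} (X t \<omega>))
        = expectation (indicator {\<omega> \<in> space M. \<not> X t \<omega> j})"
      by (intro Bochner_Integration.integral_cong) (auto simp: no_adopters_def indicator_def)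
    also have "\<dots> = \<P>(\<omega> in M. \<not> X t \<omega> j)" by simp
    also have "\<dots> = 1 - \<P>(\<omega> in M. X t \<omega> j)" by (rule prob_neg) simp
    finally show ?thesis .
  qed
  moreover have "m \<noteq> j" if "m \<in> ?nb j" for m using that lattice_neighbours_subset by auto
  ultimately show ?thesis
    using expansion[OF _ t, of "{j}" "2 * q - q / D"] j pair by auto
qed

section \<open>Comparison of the third-order terms\<close>

theorem lemma14:
  fixes p q :: real
    and M :: "nat \<Rightarrow> 'w measure"
    and X :: "nat \<Rightarrow> real \<Rightarrow> 'w \<Rightarrow> (nat \<Rightarrow> int) \<Rightarrow> bool"
  assumes "p > 0" and "q > 0"
    and "\<And>D. D \<ge> 1 \<Longrightarrow> cartesian_bass_network D p q (M D) (X D)"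
  shows "\<forall>D\<ge>1. \<exists>\<tau>>0. \<forall>t. 0 < t \<and> t < \<tau> \<longrightarrow>
           (\<forall>i\<in>lattice_nodes D. \<forall>j\<in>lattice_nodes (D + 1).
              \<P>(\<omega> in M D. X D t \<omega> i) < \<P>(\<omega> in M (D + 1). X (D + 1) t \<omega> j) \<and>
              \<P>(\<omega> in M (D + 1). X (D + 1) t \<omega> j) < f_Bass p q t)"
proof (intro allI impI)
  fix D :: nat assume D: "1 \<le> D"
  define K where "K = (5 * (p + 2 * q)) ^ 4"
  define R where "R t P = 1 - p * t + (p\<^sup>2 - p * q) / 2 * t ^ 2
            - ((p + q) * (p\<^sup>2 - p * q) - q * (4 * p\<^sup>2 - p * P)) / 6 * t ^ 3" for t P
  \<comment> \<open>Passing from \<open>D\<close> to \<open>D + 1\<close> raises \<open>P\<close> by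
    \<open>q / (D * (D + 1))\<close>, which times \<open>p * q / 6\<close> is
    \<open>\<delta>\<close>. The step from \<open>D + 1\<close> to the Bass model raises it by
    \<open>q / (D + 1)\<close>, which is no smaller, so one \<open>\<delta>\<close> serves both
    inequalities.\<close>
  define \<delta> where "\<delta> = p * q\<^sup>2 / (6 * (real D * (real D + 1)))"
  have K: "K > 0" using assms(1,2) by (simp add: K_def)
  have \<delta>: "\<delta> > 0" using assms(1,2) D by (simp add: \<delta>_def)
  \<comment> \<open>\<open>R\<close> decreases in \<open>P\<close> and approximates the nonadopter
    fraction, so a larger \<open>P\<close> means more adopters once the gap
    \<open>\<delta> * t ^ 3\<close> exceeds the two errors \<open>K * t ^ 4\<close>; this is where
    the threshold \<open>\<delta> / (2 * K)\<close> comes from.\<close>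
  have less: "x < y" if t: "0 < t" "t < \<delta> / (2 * K)" and P: "P + q / (real D * (real D + 1)) \<le> P'"
    and x: "\<bar>1 - x - R t P\<bar> \<le> K * t ^ 4" and y: "\<bar>1 - y - R t P'\<bar> \<le> K * t ^ 4" for t P P' x y
  proof -
    have "R t P - R t P' = p * q / 6 * (P' - P) * t ^ 3"
      by (simp add: R_def field_simps)
    moreover have "p * q / 6 * (q / (real D * (real D + 1))) \<le> p * q / 6 * (P' - P)"
      using P assms(1,2) by (intro mult_left_mono) auto
    then have "\<delta> \<le> p * q / 6 * (P' - P)" by (simp add: \<delta>_def power2_eq_square)
    then have "\<delta> * t ^ 3 \<le> p * q / 6 * (P' - P) * t ^ 3" using t by (intro mult_right_mono) auto
    moreover have "2 * K * t < \<delta>" using t K by (simp add: field_simps)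
    then have "2 * K * t * t ^ 3 < \<delta> * t ^ 3" using t by (intro mult_strict_right_mono) auto
    moreover have "2 * K * t * t ^ 3 = 2 * (K * t ^ 4)" by (simp add: eval_nat_numeral)
    ultimately have "2 * (K * t ^ 4) < R t P - R t P'" by linarith
    with x y show ?thesis by linarith
  qed
  show "\<exists>\<tau>>0. \<forall>t. 0 < t \<and> t < \<tau> \<longrightarrow>
           (\<forall>i\<in>lattice_nodes D. \<forall>j\<in>lattice_nodes (D + 1).
              \<P>(\<omega> in M D. X D t \<omega> i) < \<P>(\<omega> in M (D + 1). X (D + 1) t \<omega> j) \<and>
              \<P>(\<omega> in M (D + 1). X (D + 1) t \<omega> j) < f_Bass p q t)"
  proof (intro exI[of _ "\<delta> / (2 * K)"] conjI allI impI ballI)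
    show "\<delta> / (2 * K) > 0" using K \<delta> by simp
    fix t i j assume t: "0 < t \<and> t < \<delta> / (2 * K)"
      and i: "i \<in> lattice_nodes D" and j: "j \<in> lattice_nodes (D + 1)"
    have fi: "\<bar>1 - \<P>(\<omega> in M D. X D t \<omega> i) - R t (2 * q - q / D)\<bar> \<le> K * t ^ 4"
      unfolding R_def K_def using assms D t by (intro cartesian_expansion[OF _ _ _ _ i]) auto
    have fj: "\<bar>1 - \<P>(\<omega> in M (D + 1). X (D + 1) t \<omega> j) - R t (2 * q - q / (D + 1))\<bar> \<le> K * t ^ 4"
      unfolding R_def K_def using assms D t by (intro cartesian_expansion[OF _ _ _ _ j]) auto
    have fB: "\<bar>1 - f_Bass p q t - R t (2 * q)\<bar> \<le> K * t ^ 4"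
      unfolding R_def K_def using assms t by (intro f_Bass_expansion) auto
    show "\<P>(\<omega> in M D. X D t \<omega> i) < \<P>(\<omega> in M (D + 1). X (D + 1) t \<omega> j)"
    proof (rule less[OF _ _ _ fi fj])
      have "q / (real D * (real D + 1)) = q / D - q / (real D + 1)" using D by (simp add: field_simps)
      then show "2 * q - q / D + q / (real D * (real D + 1)) \<le> 2 * q - q / (D + 1)"
        by (simp add: add.commute)
    qed (use t in auto)
    show "\<P>(\<omega> in M (D + 1). X (D + 1) t \<omega> j) < f_Bass p q t"
    proof (rule less[OF _ _ _ fj fB])
      have "real D + 1 \<le> real D * (real D + 1)" using D by simp
      then have "q / (real D * (real D + 1)) \<le> q / (real D + 1)"
        using assms(2) by (intro divide_left_mono) auto
      then show "2 * q - q / (D + 1) + q / (real D * (real D + 1)) \<le> 2 * q"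
        by (simp add: add.commute)
    qed (use t in auto)
  qed
qed

end
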